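(* Let $\{(\mathbf{X}^s,\mathrm{p}^s)\in\mathbb{R}^{N^s\times N^s}\times\mathcal{P}_{N^s}\}_{s\in[S]}$ be templates, $M\in\mathbb{N}$, and $(\mathbf{Y},\mathrm{q})\in\mathbb{R}^{M\times M}\times\mathcal{P}_M$. For each $s\in[S]$ let $$F(\mathbf{Y},s):=\frac{1}{\mathrm{q}\mathrm{q}^T}\odot(\pi^s)^T\mathbf{X}^s\pi^s\in\mathbb{R}^{M\times M},$$ where $\pi^s$ is an optimal plan for $GW((\mathbf{X}^s,\mathrm{p}^s),(\mathbf{Y},\mathrm{q}))$. Consider the loss $d_a(\mathbf{X},\mathbf{Y})=\|\mathbf{Y}-\mathbf{X}\|_{\mathrm{Frob}}$ in the GW analysis problem $$\lambda_{\mathbf{Y}}:=\operatorname*{arg\,min}_{\lambda\in\Delta_{S-1}}d_a(\mathbf{Y},\mathbf{Y}_\lambda)^2,$$ where $\mathbf{Y}_\lambda$ is a solution of the GW synthesis problem with weights $\lambda$. If $\mathbf{Y}\in\mathrm{Bary}_{M,\mathrm{q}}(\{(\mathbf{X}^s,\mathrm{p}^s)\}_{s\in[S]})$, then a corresponding weight vector $\lambda_{\mathbf{Y}}\in\Delta_{S-1}$ associated with $\mathbf{Y}$ is given by a solution of the following convex quadratic minimization problem: $$\min_{\lambda\in\Delta_{S-1}}\lambda^T\mathcal{Q}\lambda,\qquad\text{where }\mathcal{Q}_{sr}:=\mathrm{tr}\big((F(\mathbf{Y},s)-\mathbf{Y})^T(F(\mathbf{Y},r)-\mathbf{Y})\big)\quad\forall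 s,r\in[S].$$ Equivalently, $\lambda_{\mathbf{Y}}$ is a solution of the following linear problem: $$K\lambda=b\qquad\text{subject to }\lambda\in\Delta_{S-1}\subset\mathbb{R}^S,$$ where $K\in\mathbb{R}^{S\times S}$ and $b\in\mathbb{R}^S$ are given by $$K_{sr}:=\mathrm{tr}\big(F(\mathbf{Y},s)^TF(\mathbf{Y},r)\big)\quad\forall s,r\in[S],\qquad b_s:=\mathrm{tr}\big(\mathbf{Y}^TF(\mathbf{Y},s)\big)\quad\forall s\in[S].$$
   Context: Notation: $S\in\mathbb{N}$; $[S]=\{1,\dots,S\}$; $\Delta_{S-1}=\{\lambda\in\mathbb{R}^S:\lambda_s\ge 0\ \forall s,\ \sum_{s\in[S]}\lambda_s=1\}$; $\mathcal{P}_N$ is the set of probability vectors in $\mathbb{R}^N$ with strictly positive entries. For $\mathrm{p}\in\mathcal{P}_N$, $\mathrm{q}\in\mathcal{P}_M$, $\Pi(\mathrm{p},\mathrm{q})=\{\pi\in\mathbb{R}^{N\times M}:\pi_{ij}\ge 0,\ \sum_j\pi_{ij}=\mathrm{p}_i,\ \sum_i\pi_{ij}=\mathrm{q}_j\}$. For $(\mathbf{X},\mathrm{p})\in\mathbb{R}^{N\times N}\times\mathcal{P}_N$ and $(\mathbf{Y},\mathrm{q})\in\mathbb{R}^{M\times M}\times\mathcal{P}_M$ (arbitrary real square matrices), the Gromov-Wasserstein (GW) discrepancy is given by $$GW((\mathbf{X},\mathrm{p}),(\mathbf{Y},\mathrm{q}))^2=\min_{\pi\in\Pi(\mathrm{p},\mathrm{q})}\sum_{i\in[N],j\in[M]}\sum_{k\in[N],l\in[M]}|\mathbf{X}_{ik}-\mathbf{Y}_{jl}|^2\pi_{ij}\pi_{kl};$$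 a minimizer $\pi$ is called an optimal plan. $\odot$ is the entrywise product, $\frac{1}{\mathrm{q}\mathrm{q}^T}$ is the $M\times M$ matrix with entries $\frac{1}{\mathrm{q}_j\mathrm{q}_l}$, and $\|A\|_{\mathrm{Frob}}=\sqrt{\mathrm{tr}(A^TA)}$. GW synthesis problem (with $M$ and $\mathrm{q}$ fixed): for $\lambda\in\Delta_{S-1}$, $$\mathbf{Y}_\lambda\in\operatorname*{arg\,min}_{\mathbf{Z}\in\mathbb{R}^{M\times M}}\sum_{s\in[S]}\lambda_s\,GW((\mathbf{X}^s,\mathrm{p}^s),(\mathbf{Z},\mathrm{q}))^2.$$ The set $\mathrm{Bary}_{M,\mathrm{q}}(\{(\mathbf{X}^s,\mathrm{p}^s)\}_{s\in[S]})$ is the set of all solutions $\mathbf{Y}_\lambda$ of the GW synthesis problem as $\lambda$ varies over $\Delta_{S-1}$. *)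

theory Defs
  imports Complex_Main "Jordan_Normal_Form.Matrix"
begin

(* Vectors and matrices are those of Jordan_Normal_Form, hence indexed from 0:
   the index set [n] = {1, ..., n} is rendered as {0, ..., n - 1}.  A family of templates
   (X^s, p^s), s in [S], is a pair of functions X, p on nat, used only at arguments s < S,
   so that the sizes N^s may depend on s. *)

definition pos_prob_vecs :: "nat \<Rightarrow> real vec set" where
  "pos_prob_vecs n = {p \<in> carrier_vec n. (\<forall>i<n. 0 < p $ i) \<and> (\<Sum>i<n. p $ i) = 1}"

definition simplex :: "nat \<Rightarrow> real vec set" where
  "simplex S = {w \<in> carrier_vec S. (\<forall>s<S. 0 \<le> w $ s) \<and> (\<Sum>s<S. w $ s) = 1}"

definition couplings :: "real vec \<Rightarrow> real vec \<Rightarrow> real mat set" where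
  "couplings p q = {\<pi> \<in> carrier_mat (dim_vec p) (dim_vec q).
     (\<forall>i<dim_vec p. \<forall>j<dim_vec q. 0 \<le> \<pi> $$ (i, j)) \<and>
     (\<forall>i<dim_vec p. (\<Sum>j<dim_vec q. \<pi> $$ (i, j)) = p $ i) \<and>
     (\<forall>j<dim_vec q. (\<Sum>i<dim_vec p. \<pi> $$ (i, j)) = q $ j)}"

definition gw_cost :: "real mat \<Rightarrow> real mat \<Rightarrow> real mat \<Rightarrow> real" where
  "gw_cost X Y \<pi> = (\<Sum>i<dim_row X. \<Sum>j<dim_row Y. \<Sum>k<dim_row X. \<Sum>l<dim_row Y.
     \<bar>X $$ (i, k) - Y $$ (j, l)\<bar>\<^sup>2 * \<pi> $$ (i, j) * \<pi> $$ (k, l))"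

(* The set of couplings is nonempty and compact and the cost is continuous and nonnegative on it,
   so the infimum is a minimum. *)
definition GW :: "real mat \<Rightarrow> real vec \<Rightarrow> real mat \<Rightarrow> real vec \<Rightarrow> real" where
  "GW X p Y q = sqrt (INF \<pi>\<in>couplings p q. gw_cost X Y \<pi>)"

definition optimal_plan :: "real mat \<Rightarrow> real vec \<Rightarrow> real mat \<Rightarrow> real vec \<Rightarrow> real mat \<Rightarrow> bool" where
  "optimal_plan X p Y q \<pi> \<longleftrightarrow> is_arg_min (gw_cost X Y) (\<lambda>\<pi>. \<pi> \<in> couplings p q) \<pi>"

definition trace :: "real mat \<Rightarrow> real" where
  "trace A = (\<Sum>i<dim_row A. A $$ (i, i))"

definition frob_norm :: "real mat \<Rightarrow> real" where
  "frob_norm A = sqrt (trace (transpose_mat A * A))"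

definition hadamard :: "real mat \<Rightarrow> real mat \<Rightarrow> real mat" (infixl \<open>\<odot>\<close> 70) where
  "A \<odot> B = mat (dim_row A) (dim_col A) (\<lambda>(i, j). A $$ (i, j) * B $$ (i, j))"

definition recip_outer :: "real vec \<Rightarrow> real mat" where
  "recip_outer q = mat (dim_vec q) (dim_vec q) (\<lambda>(j, l). 1 / (q $ j * q $ l))"

definition synthesis_loss ::
  "nat \<Rightarrow> (nat \<Rightarrow> real mat) \<Rightarrow> (nat \<Rightarrow> real vec) \<Rightarrow> real vec \<Rightarrow> real vec \<Rightarrow> real mat \<Rightarrow> real" where
  "synthesis_loss S X p q w Z = (\<Sum>s<S. w $ s * (GW (X s) (p s) Z q)\<^sup>2)"

definition synthesis_solutions ::
  "nat \<Rightarrow> (nat \<Rightarrow> real mat) \<Rightarrow> (nat \<Rightarrow> real vec) \<Rightarrow> real vec \<Rightarrow> real vec \<Rightarrow> real mat set" where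
  "synthesis_solutions S X p q w =
     {Y. is_arg_min (synthesis_loss S X p q w) (\<lambda>Z. Z \<in> carrier_mat (dim_vec q) (dim_vec q)) Y}"

definition Bary ::
  "nat \<Rightarrow> (nat \<Rightarrow> real mat) \<Rightarrow> (nat \<Rightarrow> real vec) \<Rightarrow> real vec \<Rightarrow> real mat set" where
  "Bary S X p q = (\<Union>w\<in>simplex S. synthesis_solutions S X p q w)"

definition d_a :: "real mat \<Rightarrow> real mat \<Rightarrow> real" where
  "d_a X Y = frob_norm (Y - X)"

(* Solutions of the synthesis problem need not be unique, so the minimization in the analysis
   problem runs over all pairs (w, Z) of a weight vector w and a solution Z of the synthesis problem
   with weights w.  A solution of the analysis problem is the weight component of a minimizer. *)
definition analysis_solutions ::
  "nat \<Rightarrow> (nat \<Rightarrow> real mat) \<Rightarrow> (nat \<Rightarrow> real vec) \<Rightarrow> real vec \<Rightarrow> real mat \<Rightarrow> real vec set" where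
  "analysis_solutions S X p q Y =
     {w. \<exists>Z. is_arg_min (\<lambda>(w, Z). (d_a Y Z)\<^sup>2)
               (\<lambda>(w, Z). w \<in> simplex S \<and> Z \<in> synthesis_solutions S X p q w) (w, Z)}"

end

theory Submission
  imports Defs
begin

text \<open>For a fixed plan the Gromov--Wasserstein cost is, up to a constant, the squared distance
  of \<open>Z\<close> to \<open>F s\<close> weighted by \<open>q\<^sub>j q\<^sub>l\<close>. A minimizer \<open>Y\<close> of the synthesis loss also minimizes the loss
  obtained by freezing the plans that are optimal at \<open>Y\<close>, since the frozen loss lies above the true
  one and agrees with it at \<open>Y\<close>. Hence \<open>Y\<close> is the convex combination \<open>\<Sum>s. w\<^sub>s F s\<close>, which is to say
  that the quadratic form of the Gram matrix of the \<open>F s - Y\<close> vanishes at \<open>w\<close>.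
  In the linear problem the residual is orthogonal to every \<open>F s\<close>, hence also to \<open>Y\<close>, hence to itself.\<close>

section \<open>Frobenius inner product and norm in coordinates\<close>

lemma trace_transpose_mult:
  assumes "A \<in> carrier_mat m n" and "B \<in> carrier_mat m n"
  shows "trace (transpose_mat A * B) = (\<Sum>j<n. \<Sum>i<m. A $$ (i, j) * B $$ (i, j))"
  using assms by (simp add: trace_def scalar_prod_def atLeast0LessThan)

lemma frob_norm_power2:
  assumes "A \<in> carrier_mat m n"
  shows "(frob_norm A)\<^sup>2 = (\<Sum>j<n. \<Sum>i<m. (A $$ (i, j))\<^sup>2)"
  unfolding frob_norm_def trace_transpose_mult[OF assms assms]
  by (simp add: sum_nonneg flip: power2_eq_square)

lemma d_a_power2_eq_0_iff:
  assumes A: "A \<in> carrier_mat m n" and B: "B \<in> carrier_mat m n"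
  shows "(d_a A B)\<^sup>2 = 0 \<longleftrightarrow> B = A"
proof
  assume *: "(d_a A B)\<^sup>2 = 0"
  have "B - A \<in> carrier_mat m n" by (rule minus_carrier_mat[OF A])
  from frob_norm_power2[OF this] *
  have "\<forall>j\<in>{..<n}. \<forall>i\<in>{..<m}. ((B - A) $$ (i, j))\<^sup>2 = 0"
    unfolding d_a_def by (simp add: sum_nonneg_eq_0_iff sum_nonneg)
  with A B show "B = A" by (intro eq_matI) auto
next
  assume "B = A"
  moreover have "A - A \<in> carrier_mat m n" by (rule minus_carrier_mat[OF A])
  ultimately show "(d_a A B)\<^sup>2 = 0"
    using frob_norm_power2[of "A - A" m n] A unfolding d_a_def by simp
qed

section \<open>Quadratic forms of Gram matrices\<close>

text \<open>The right-hand side is the squared Frobenius norm of the combination of the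
  \<open>D s\<close> with coefficients \<open>u\<close>. So the form is nonnegative and vanishes
  exactly where this combination does.\<close>

lemma quadratic_form_gram:
  fixes D :: "nat \<Rightarrow> real mat"
  assumes D: "\<And>s. s < S \<Longrightarrow> D s \<in> carrier_mat m n"
    and u: "u \<in> carrier_vec S"
  shows "u \<bullet> (mat S S (\<lambda>(s, r). trace (transpose_mat (D s) * D r)) *\<^sub>v u)
    = (\<Sum>j<n. \<Sum>i<m. (\<Sum>s<S. u $ s * D s $$ (i, j))\<^sup>2)"
proof -
  have "u \<bullet> (mat S S (\<lambda>(s, r). trace (transpose_mat (D s) * D r)) *\<^sub>v u)
    = (\<Sum>s<S. \<Sum>r<S. \<Sum>j<n. \<Sum>i<m. (u $ s * D s $$ (i, j)) * (u $ r * D r $$ (i, j)))"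
    using u D
    by (simp add: scalar_prod_def atLeast0LessThan trace_transpose_mult[of _ m n]
        sum_distrib_left sum_distrib_right mult_ac)
  \<comment> \<open>The sums over entries move outside, so that for each entry the double sum over
    \<open>s\<close> and \<open>r\<close> factors into a square.\<close>
  also have "\<dots> = (\<Sum>j<n. \<Sum>s<S. \<Sum>r<S. \<Sum>i<m. (u $ s * D s $$ (i, j)) * (u $ r * D r $$ (i, j)))"
    by (subst (2) sum.swap, subst sum.swap) (rule refl)
  also have "\<dots> = (\<Sum>j<n. \<Sum>i<m. \<Sum>s<S. \<Sum>r<S. (u $ s * D s $$ (i, j)) * (u $ r * D r $$ (i, j)))"
    by (subst (3) sum.swap, subst (2) sum.swap) (rule refl)
  also have "\<dots> = (\<Sum>j<n. \<Sum>i<m. (\<Sum>s<S. u $ s * D s $$ (i, j))\<^sup>2)"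
    by (simp add: power2_eq_square sum_product)
  finally show ?thesis .
qed

lemma power2_convex:
  fixes a b t :: real
  assumes "0 \<le> t" and "t \<le> 1"
  shows "(t * a + (1 - t) * b)\<^sup>2 \<le> t * a\<^sup>2 + (1 - t) * b\<^sup>2"
proof -
  have "t * a\<^sup>2 + (1 - t) * b\<^sup>2 - (t * a + (1 - t) * b)\<^sup>2 = t * (1 - t) * (a - b)\<^sup>2"
    by (simp add: power2_eq_square algebra_simps)
  moreover have "0 \<le> t * (1 - t) * (a - b)\<^sup>2" using assms by simp
  ultimately show ?thesis by linarith
qed

text \<open>The form is a sum of squares of functionals that are linear in the coefficient vector,
  so convexity of the real square, applied entry by entry, is enough.\<close>

lemma quadratic_form_gram_convex:
  fixes D :: "nat \<Rightarrow> real mat" and t :: real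
  assumes D: "\<And>s. s < S \<Longrightarrow> D s \<in> carrier_mat m n"
    and Q: "Q = mat S S (\<lambda>(s, r). trace (transpose_mat (D s) * D r))"
    and u: "u \<in> carrier_vec S" and v: "v \<in> carrier_vec S" and t: "0 \<le> t" "t \<le> 1"
  shows "(t \<cdot>\<^sub>v u + (1 - t) \<cdot>\<^sub>v v) \<bullet> (Q *\<^sub>v (t \<cdot>\<^sub>v u + (1 - t) \<cdot>\<^sub>v v))
    \<le> t * (u \<bullet> (Q *\<^sub>v u)) + (1 - t) * (v \<bullet> (Q *\<^sub>v v))"
proof -
  let ?c = "\<lambda>x i j. \<Sum>s<S. x $ s * D s $$ (i, j)"
  have comb: "?c (t \<cdot>\<^sub>v u + (1 - t) \<cdot>\<^sub>v v) i j = t * ?c u i j + (1 - t) * ?c v i j" for i j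
    unfolding sum_distrib_left sum.distrib[symmetric]
    using u v by (intro sum.cong refl) (simp add: algebra_simps)
  have "(t \<cdot>\<^sub>v u + (1 - t) \<cdot>\<^sub>v v) \<bullet> (Q *\<^sub>v (t \<cdot>\<^sub>v u + (1 - t) \<cdot>\<^sub>v v))
    = (\<Sum>j<n. \<Sum>i<m. (?c (t \<cdot>\<^sub>v u + (1 - t) \<cdot>\<^sub>v v) i j)\<^sup>2)"
    unfolding Q using u v by (intro quadratic_form_gram[OF D]) auto
  also have "\<dots> \<le> (\<Sum>j<n. \<Sum>i<m. t * (?c u i j)\<^sup>2 + (1 - t) * (?c v i j)\<^sup>2)"
    unfolding comb by (intro sum_mono power2_convex t)
  also have "\<dots> = t * (u \<bullet> (Q *\<^sub>v u)) + (1 - t) * (v \<bullet> (Q *\<^sub>v v))"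
    unfolding Q using quadratic_form_gram[OF D u] quadratic_form_gram[OF D v]
    by (simp only: sum.distrib sum_distrib_left)
  finally show ?thesis .
qed

section \<open>The discrepancy as an infimum over couplings\<close>

lemma gw_cost_nonneg:
  assumes "dim_row X = dim_vec p" and "dim_row Y = dim_vec q" and "\<pi> \<in> couplings p q"
  shows "0 \<le> gw_cost X Y \<pi>"
  using assms unfolding gw_cost_def couplings_def by (auto intro!: sum_nonneg mult_nonneg_nonneg)

lemma GW_power2:
  assumes "dim_row X = dim_vec p" and "dim_row Y = dim_vec q" and "couplings p q \<noteq> {}"
  shows "(GW X p Y q)\<^sup>2 = (INF \<pi>\<in>couplings p q. gw_cost X Y \<pi>)"
  unfolding GW_def using assms by (intro real_sqrt_pow2 cINF_greatest gw_cost_nonneg)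

text \<open>Costs are bounded below by 0, so the infimum lies below each of them. This serves for
  plans that are optimal for a matrix other than \<open>Y\<close>.\<close>

lemma GW_power2_le_gw_cost:
  assumes dims: "dim_row X = dim_vec p" "dim_row Y = dim_vec q" and \<pi>: "\<pi> \<in> couplings p q"
  shows "(GW X p Y q)\<^sup>2 \<le> gw_cost X Y \<pi>"
proof -
  have "couplings p q \<noteq> {}" using \<pi> by auto
  moreover have "bdd_below (gw_cost X Y ` couplings p q)"
    using gw_cost_nonneg[OF dims] by (intro bdd_belowI2[where m = 0])
  ultimately show ?thesis
    using GW_power2[OF dims] cINF_lower[OF _ \<pi>] by metis
qed

text \<open>An optimal plan is a coupling whose cost is a lower bound of all costs, so the infimum
  is attained there.\<close>

lemma GW_power2_optimal_plan:
  assumes dims: "dim_row X = dim_vec p" "dim_row Y = dim_vec q" and opt: "optimal_plan X p Y q \<pi>"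
  shows "(GW X p Y q)\<^sup>2 = gw_cost X Y \<pi>"
proof (rule antisym)
  have \<pi>: "\<pi> \<in> couplings p q" and min: "\<And>\<rho>. \<rho> \<in> couplings p q \<Longrightarrow> gw_cost X Y \<pi> \<le> gw_cost X Y \<rho>"
    using opt unfolding optimal_plan_def is_arg_min_linorder by auto
  show "(GW X p Y q)\<^sup>2 \<le> gw_cost X Y \<pi>" by (rule GW_power2_le_gw_cost[OF dims \<pi>])
  have ne: "couplings p q \<noteq> {}" using \<pi> by auto
  show "gw_cost X Y \<pi> \<le> (GW X p Y q)\<^sup>2"
    unfolding GW_power2[OF dims ne] by (rule cINF_greatest[OF ne min])
qed

section \<open>The cost of a fixed plan as a function of the target matrix\<close>

lemma index_transpose_mult_mult:
  fixes X \<pi> :: "'a :: comm_semiring_0 mat"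
  assumes "X \<in> carrier_mat n n" and "\<pi> \<in> carrier_mat n m" and "j < m" and "l < m"
  shows "(transpose_mat \<pi> * X * \<pi>) $$ (j, l)
    = (\<Sum>i<n. \<Sum>k<n. X $$ (i, k) * \<pi> $$ (i, j) * \<pi> $$ (k, l))"
  using assms by (simp add: scalar_prod_def atLeast0LessThan sum_distrib_left mult_ac)

text \<open>Expanding the square gives a quadratic polynomial in each entry of \<open>Z\<close>,
  with leading coefficient \<open>q $ j * q $ l\<close> by the column marginals of \<pi>. Completing
  the square centres it at \<open>F\<close>, which explains the factor \<open>recip_outer q\<close>.
  Only the last summand depends on \<open>Z\<close>.\<close>

lemma gw_cost_complete_square:
  assumes X: "X \<in> carrier_mat n n" and p: "dim_vec p = n"
    and q: "dim_vec q = m" "\<And>j. j < m \<Longrightarrow> q $ j \<noteq> 0" and \<pi>: "\<pi> \<in> couplings p q"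
    and Z: "Z \<in> carrier_mat m m"
    and F: "F = recip_outer q \<odot> (transpose_mat \<pi> * X * \<pi>)"
  shows "gw_cost X Z \<pi> = (\<Sum>j<m. \<Sum>l<m.
      (\<Sum>i<n. \<Sum>k<n. (X $$ (i, k))\<^sup>2 * \<pi> $$ (i, j) * \<pi> $$ (k, l))
      - q $ j * q $ l * (F $$ (j, l))\<^sup>2 + q $ j * q $ l * (Z $$ (j, l) - F $$ (j, l))\<^sup>2)"
proof -
  have \<pi>c: "\<pi> \<in> carrier_mat n m" and col: "\<And>j. j < m \<Longrightarrow> (\<Sum>i<n. \<pi> $$ (i, j)) = q $ j"
    using \<pi> p q(1) unfolding couplings_def by auto
  let ?f = "\<lambda>i j k l. \<bar>X $$ (i, k) - Z $$ (j, l)\<bar>\<^sup>2 * \<pi> $$ (i, j) * \<pi> $$ (k, l)"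
  have "gw_cost X Z \<pi> = (\<Sum>j<m. \<Sum>i<n. \<Sum>k<n. \<Sum>l<m. ?f i j k l)"
    unfolding gw_cost_def using X Z by (subst sum.swap) auto
  also have "\<dots> = (\<Sum>j<m. \<Sum>l<m. \<Sum>i<n. \<Sum>k<n. ?f i j k l)"
    by (subst (3) sum.swap, subst (2) sum.swap) (rule refl)
  also have "\<dots> = (\<Sum>j<m. \<Sum>l<m.
      (\<Sum>i<n. \<Sum>k<n. (X $$ (i, k))\<^sup>2 * \<pi> $$ (i, j) * \<pi> $$ (k, l))
      - q $ j * q $ l * (F $$ (j, l))\<^sup>2 + q $ j * q $ l * (Z $$ (j, l) - F $$ (j, l))\<^sup>2)"
  proof (intro sum.cong refl)
    fix j l assume "j \<in> {..<m}" and "l \<in> {..<m}"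
    then have j: "j < m" and l: "l < m" by auto
    let ?B = "\<Sum>i<n. \<Sum>k<n. X $$ (i, k) * \<pi> $$ (i, j) * \<pi> $$ (k, l)"
    have mass: "(\<Sum>i<n. \<Sum>k<n. \<pi> $$ (i, j) * \<pi> $$ (k, l)) = q $ j * q $ l"
      using col[OF j] col[OF l] by (simp flip: sum_product)
    have "F $$ (j, l) = 1 / (q $ j * q $ l) * (transpose_mat \<pi> * X * \<pi>) $$ (j, l)"
      using j l q(1) unfolding F hadamard_def recip_outer_def by simp
    \<comment> \<open>The definition of \<open>F\<close> is solved for the double sum
      \<open>?B\<close>; the entries of \<open>q\<close> being nonzero makes this possible.\<close>
    then have B: "?B = q $ j * q $ l * F $$ (j, l)"
      using q(2)[OF j] q(2)[OF l] index_transpose_mult_mult[OF X \<pi>c j l] by simp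
    have "(\<Sum>i<n. \<Sum>k<n. ?f i j k l)
      = (\<Sum>i<n. \<Sum>k<n. (X $$ (i, k))\<^sup>2 * \<pi> $$ (i, j) * \<pi> $$ (k, l)
          - 2 * Z $$ (j, l) * (X $$ (i, k) * \<pi> $$ (i, j) * \<pi> $$ (k, l))
          + (Z $$ (j, l))\<^sup>2 * (\<pi> $$ (i, j) * \<pi> $$ (k, l)))"
      by (intro sum.cong refl) (simp add: power2_eq_square algebra_simps)
    also have "\<dots> = (\<Sum>i<n. \<Sum>k<n. (X $$ (i, k))\<^sup>2 * \<pi> $$ (i, j) * \<pi> $$ (k, l))
        - 2 * Z $$ (j, l) * ?B + (Z $$ (j, l))\<^sup>2 * (q $ j * q $ l)"
      unfolding mass[symmetric] by (simp only: sum.distrib sum_subtractf sum_distrib_left)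
    also have "\<dots> = (\<Sum>i<n. \<Sum>k<n. (X $$ (i, k))\<^sup>2 * \<pi> $$ (i, j) * \<pi> $$ (k, l))
        - q $ j * q $ l * (F $$ (j, l))\<^sup>2 + q $ j * q $ l * (Z $$ (j, l) - F $$ (j, l))\<^sup>2"
      unfolding B by (simp add: power2_eq_square algebra_simps)
    finally show "(\<Sum>i<n. \<Sum>k<n. ?f i j k l)
      = (\<Sum>i<n. \<Sum>k<n. (X $$ (i, k))\<^sup>2 * \<pi> $$ (i, j) * \<pi> $$ (k, l))
        - q $ j * q $ l * (F $$ (j, l))\<^sup>2 + q $ j * q $ l * (Z $$ (j, l) - F $$ (j, l))\<^sup>2" .
  qed
  finally show ?thesis .
qed

text \<open>The terms of the completed square that do not involve the target matrix cancel.\<close>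

lemma gw_cost_diff:
  assumes "X \<in> carrier_mat n n" and "dim_vec p = n"
    and "dim_vec q = m" "\<And>j. j < m \<Longrightarrow> q $ j \<noteq> 0" and "\<pi> \<in> couplings p q"
    and "Y \<in> carrier_mat m m" and "Z \<in> carrier_mat m m"
    and "F = recip_outer q \<odot> (transpose_mat \<pi> * X * \<pi>)"
  shows "gw_cost X Z \<pi> - gw_cost X Y \<pi> = (\<Sum>j<m. \<Sum>l<m.
      q $ j * q $ l * ((Z $$ (j, l) - F $$ (j, l))\<^sup>2 - (Y $$ (j, l) - F $$ (j, l))\<^sup>2))"
  using gw_cost_complete_square[OF assms(1-5) assms(7,8)]
    gw_cost_complete_square[OF assms(1-5) assms(6,8)]
  by (simp add: algebra_simps flip: sum_subtractf)

section \<open>Synthesis solutions are weighted means\<close>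

text \<open>This is the bias-variance identity: moving from \<open>y\<close> to the weighted mean
  \<open>g\<close> lowers the weighted sum of squared distances by exactly the squared distance from
  \<open>y\<close> to \<open>g\<close>.\<close>

lemma weighted_power2_dist_mean:
  fixes w f :: "nat \<Rightarrow> real"
  assumes w: "(\<Sum>s<S. w s) = 1" and g: "g = (\<Sum>s<S. w s * f s)"
  shows "(\<Sum>s<S. w s * ((g - f s)\<^sup>2 - (y - f s)\<^sup>2)) = - (y - g)\<^sup>2"
proof -
  have "(\<Sum>s<S. w s * ((g - f s)\<^sup>2 - (y - f s)\<^sup>2))
    = (\<Sum>s<S. (g\<^sup>2 - y\<^sup>2) * w s + 2 * (y - g) * (w s * f s))"
    by (intro sum.cong refl) (simp add: power2_eq_square algebra_simps)
  also have "\<dots> = (g\<^sup>2 - y\<^sup>2) + 2 * (y - g) * g"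
    unfolding sum.distrib g sum_distrib_left[symmetric] w by simp
  finally show ?thesis by (simp add: power2_eq_square algebra_simps)
qed

lemma synthesis_solution_eq_mean:
  assumes X: "\<And>s. s < S \<Longrightarrow> X s \<in> carrier_mat (N s) (N s)"
    and p: "\<And>s. s < S \<Longrightarrow> p s \<in> pos_prob_vecs (N s)"
    and Y: "Y \<in> carrier_mat M M" and q: "q \<in> pos_prob_vecs M"
    and plan: "\<And>s. s < S \<Longrightarrow> optimal_plan (X s) (p s) Y q (\<pi> s)"
    and F: "\<And>s. s < S \<Longrightarrow> F s = recip_outer q \<odot> (transpose_mat (\<pi> s) * X s * \<pi> s)"
    and w: "w \<in> simplex S" and sol: "Y \<in> synthesis_solutions S X p q w"
    and i: "i < M" and j: "j < M"
  shows "Y $$ (i, j) = (\<Sum>s<S. w $ s * F s $$ (i, j))"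
proof -
  have qd: "dim_vec q = M" and qpos: "\<And>j. j < M \<Longrightarrow> 0 < q $ j"
    using q unfolding pos_prob_vecs_def by auto
  then have qnz: "\<And>j. j < M \<Longrightarrow> q $ j \<noteq> 0" by force
  have pd: "dim_vec (p s) = N s" if "s < S" for s
    using p[OF that] unfolding pos_prob_vecs_def by auto
  have \<pi>: "\<pi> s \<in> couplings (p s) q" if "s < S" for s
    using plan[OF that] unfolding optimal_plan_def is_arg_min_def by auto
  have w0: "\<And>s. s < S \<Longrightarrow> 0 \<le> w $ s" and w1: "(\<Sum>s<S. w $ s) = 1"
    using w unfolding simplex_def by auto
  \<comment> \<open>The competitor to \<open>Y\<close> is the weighted mean of the
    \<open>F s\<close>, at which the loss with the plans \<open>\<pi> s\<close> frozen is
    smallest.\<close>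
  define G where "G = mat M M (\<lambda>(i, j). \<Sum>s<S. w $ s * F s $$ (i, j))"
  have G: "G \<in> carrier_mat M M" unfolding G_def by simp
  have dX: "dim_row (X s) = dim_vec (p s)" if "s < S" for s
    using X[OF that] pd[OF that] by auto
  have dG: "dim_row G = dim_vec q" and dY: "dim_row Y = dim_vec q" using G Y qd by auto
  have "synthesis_loss S X p q w Y \<le> synthesis_loss S X p q w G"
    using sol G qd unfolding synthesis_solutions_def is_arg_min_linorder by auto
  \<comment> \<open>The plans are optimal at \<open>Y\<close> and merely couplings at
    \<open>G\<close>, hence an inequality here and an equality for the loss at \<open>Y\<close>
    below. Multiplying by the weights keeps the inequality because they are nonnegative.\<close>
  also have "\<dots> \<le> (\<Sum>s<S. w $ s * gw_cost (X s) G (\<pi> s))"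
    unfolding synthesis_loss_def
    by (intro sum_mono mult_left_mono GW_power2_le_gw_cost) (auto simp: w0 dX dG \<pi>)
  finally have "0 \<le> (\<Sum>s<S. w $ s * gw_cost (X s) G (\<pi> s)) - synthesis_loss S X p q w Y"
    by simp
  also have "synthesis_loss S X p q w Y = (\<Sum>s<S. w $ s * gw_cost (X s) Y (\<pi> s))"
    unfolding synthesis_loss_def
    by (intro sum.cong refl) (simp add: GW_power2_optimal_plan dX dY plan)
  also have "(\<Sum>s<S. w $ s * gw_cost (X s) G (\<pi> s)) - (\<Sum>s<S. w $ s * gw_cost (X s) Y (\<pi> s))
    = (\<Sum>s<S. w $ s * (gw_cost (X s) G (\<pi> s) - gw_cost (X s) Y (\<pi> s)))"
    by (simp add: right_diff_distrib sum_subtractf)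
  also have "\<dots> = (\<Sum>s<S. \<Sum>j<M. \<Sum>l<M. q $ j * q $ l *
      (w $ s * ((G $$ (j, l) - F s $$ (j, l))\<^sup>2 - (Y $$ (j, l) - F s $$ (j, l))\<^sup>2)))"
  proof (intro sum.cong refl)
    fix s assume "s \<in> {..<S}"
    then have s: "s < S" by simp
    show "w $ s * (gw_cost (X s) G (\<pi> s) - gw_cost (X s) Y (\<pi> s)) = (\<Sum>j<M. \<Sum>l<M. q $ j * q $ l *
      (w $ s * ((G $$ (j, l) - F s $$ (j, l))\<^sup>2 - (Y $$ (j, l) - F s $$ (j, l))\<^sup>2)))"
      by (subst gw_cost_diff[OF X[OF s] pd[OF s] qd _ \<pi>[OF s] Y G F[OF s]])
        (simp_all add: qnz sum_distrib_left mult_ac)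
  qed
  \<comment> \<open>The factors \<open>q $ j * q $ l\<close> are the same for all \<open>s\<close>,
    so the sum over \<open>s\<close> can be taken within each entry.\<close>
  also have "\<dots> = (\<Sum>j<M. \<Sum>l<M. q $ j * q $ l *
      (\<Sum>s<S. w $ s * ((G $$ (j, l) - F s $$ (j, l))\<^sup>2 - (Y $$ (j, l) - F s $$ (j, l))\<^sup>2)))"
    unfolding sum_distrib_left by (subst sum.swap, subst (2) sum.swap) (rule refl)
  also have "\<dots> = (\<Sum>j<M. \<Sum>l<M. q $ j * q $ l * - (Y $$ (j, l) - G $$ (j, l))\<^sup>2)"
    by (intro sum.cong refl arg_cong2[where f = "(*)"] weighted_power2_dist_mean w1)
      (simp add: G_def)
  \<comment> \<open>A sum of nonnegative terms is at most 0, so every term vanishes; as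
    \<open>q\<close> has positive entries, \<open>Y\<close> and \<open>G\<close> agree.\<close>
  finally have "(\<Sum>j<M. \<Sum>l<M. q $ j * q $ l * (Y $$ (j, l) - G $$ (j, l))\<^sup>2) \<le> 0"
    by (simp add: sum_negf)
  moreover have nn: "0 \<le> q $ j * q $ l * (Y $$ (j, l) - G $$ (j, l))\<^sup>2"
    if "j < M" "l < M" for j l
    using qpos[OF that(1)] qpos[OF that(2)] by simp
  ultimately have "(\<Sum>j<M. \<Sum>l<M. q $ j * q $ l * (Y $$ (j, l) - G $$ (j, l))\<^sup>2) = 0"
    by (intro antisym sum_nonneg) auto
  then have "(\<Sum>l<M. q $ i * q $ l * (Y $$ (i, l) - G $$ (i, l))\<^sup>2) = 0"
    using i nn by (subst (asm) sum_nonneg_eq_0_iff) (auto intro!: sum_nonneg)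
  then have "q $ i * q $ j * (Y $$ (i, j) - G $$ (i, j))\<^sup>2 = 0"
    using i j nn by (subst (asm) sum_nonneg_eq_0_iff) auto
  then show ?thesis
    using i j qnz[OF i] qnz[OF j] by (simp add: G_def)
qed

section \<open>Two characterizations of the weights that represent \<open>Y\<close>\<close>

text \<open>The weights sum to 1, so the combination of the \<open>F s - Y\<close> is the mean of
  the \<open>F s\<close> minus \<open>Y\<close>; the quadratic form is its squared Frobenius
  norm.\<close>

lemma mean_eq_iff_quadratic_form_0:
  assumes F: "\<And>s. s < S \<Longrightarrow> F s \<in> carrier_mat m n" and Y: "Y \<in> carrier_mat m n"
    and Q: "Q = mat S S (\<lambda>(s, r). trace (transpose_mat (F s - Y) * (F r - Y)))"
    and w: "w \<in> simplex S"
  shows "w \<bullet> (Q *\<^sub>v w) = 0 \<longleftrightarrow> (\<forall>i<m. \<forall>j<n. Y $$ (i, j) = (\<Sum>s<S. w $ s * F s $$ (i, j)))"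
proof -
  have wc: "w \<in> carrier_vec S" and w1: "(\<Sum>s<S. w $ s) = 1"
    using w unfolding simplex_def by auto
  have D: "F s - Y \<in> carrier_mat m n" if "s < S" for s by (rule minus_carrier_mat[OF Y])
  have comb: "(\<Sum>s<S. w $ s * (F s - Y) $$ (i, j)) = (\<Sum>s<S. w $ s * F s $$ (i, j)) - Y $$ (i, j)"
    if "i < m" "j < n" for i j
  proof -
    have "(\<Sum>s<S. w $ s * (F s - Y) $$ (i, j)) = (\<Sum>s<S. w $ s * F s $$ (i, j) - w $ s * Y $$ (i, j))"
      using that F Y by (intro sum.cong refl) (auto simp: right_diff_distrib)
    then show ?thesis by (simp add: sum_subtractf w1 flip: sum_distrib_right)
  qed
  have "w \<bullet> (Q *\<^sub>v w) = (\<Sum>j<n. \<Sum>i<m. ((\<Sum>s<S. w $ s * F s $$ (i, j)) - Y $$ (i, j))\<^sup>2)"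
    unfolding Q using quadratic_form_gram[where D = "\<lambda>s. F s - Y", OF D wc] by (simp add: comb)
  also have "\<dots> = 0 \<longleftrightarrow> (\<forall>i<m. \<forall>j<n. Y $$ (i, j) = (\<Sum>s<S. w $ s * F s $$ (i, j)))"
    by (auto simp: sum_nonneg_eq_0_iff sum_nonneg)
  finally show ?thesis .
qed

text \<open>These are normal equations: coordinate \<open>s\<close> of the residual
  \<open>K *\<^sub>v w - b\<close> is the Frobenius inner product of \<open>F s\<close> with the
  matrix residual \<open>R\<close>. By \<open>span\<close> the matrix \<open>Y\<close>, and with it
  \<open>R\<close>, lies in the span of the \<open>F s\<close>, so orthogonality to every
  \<open>F s\<close> forces \<open>R\<close> to be 0.\<close>

lemma mean_eq_iff_linear_system:
  assumes F: "\<And>s. s < S \<Longrightarrow> F s \<in> carrier_mat m n" and Y: "Y \<in> carrier_mat m n"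
    and K: "K = mat S S (\<lambda>(s, r). trace (transpose_mat (F s) * F r))"
    and b: "b = vec S (\<lambda>s. trace (transpose_mat Y * F s))"
    and span: "\<And>i j. i < m \<Longrightarrow> j < n \<Longrightarrow> Y $$ (i, j) = (\<Sum>s<S. v $ s * F s $$ (i, j))"
    and w: "w \<in> carrier_vec S"
  shows "K *\<^sub>v w = b \<longleftrightarrow> (\<forall>i<m. \<forall>j<n. Y $$ (i, j) = (\<Sum>s<S. w $ s * F s $$ (i, j)))"
proof -
  define R where "R i j = (\<Sum>s<S. w $ s * F s $$ (i, j)) - Y $$ (i, j)" for i j
  have res: "(K *\<^sub>v w) $ s - b $ s = (\<Sum>j<n. \<Sum>i<m. F s $$ (i, j) * R i j)" if s: "s < S" for s
  proof -
    have "(K *\<^sub>v w) $ s = (\<Sum>r<S. \<Sum>j<n. \<Sum>i<m. F s $$ (i, j) * (w $ r * F r $$ (i, j)))"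
      using s w F unfolding K
      by (simp add: scalar_prod_def atLeast0LessThan trace_transpose_mult[of _ m n]
          sum_distrib_left sum_distrib_right mult_ac)
    also have "\<dots> = (\<Sum>j<n. \<Sum>i<m. F s $$ (i, j) * (\<Sum>r<S. w $ r * F r $$ (i, j)))"
      unfolding sum_distrib_left by (subst sum.swap, subst (2) sum.swap) (rule refl)
    finally show ?thesis
      using s Y F unfolding b R_def
      by (simp add: trace_transpose_mult[of _ m n] right_diff_distrib sum_subtractf mult_ac)
  qed
  have "K *\<^sub>v w = b \<longleftrightarrow> (\<forall>s<S. (K *\<^sub>v w) $ s - b $ s = 0)"
    unfolding K b by (auto simp: vec_eq_iff)
  also have "\<dots> \<longleftrightarrow> (\<forall>s<S. (\<Sum>j<n. \<Sum>i<m. F s $$ (i, j) * R i j) = 0)"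
    by (simp add: res)
  also have "\<dots> \<longleftrightarrow> (\<forall>i<m. \<forall>j<n. R i j = 0)"
  proof
    assume orth: "\<forall>s<S. (\<Sum>j<n. \<Sum>i<m. F s $$ (i, j) * R i j) = 0"
    have comb: "(\<Sum>j<n. \<Sum>i<m. (\<Sum>s<S. u $ s * F s $$ (i, j)) * R i j) = 0" for u :: "real vec"
    proof -
      have "(\<Sum>s<S. u $ s * (\<Sum>j<n. \<Sum>i<m. F s $$ (i, j) * R i j)) = 0"
        using orth by simp
      then show ?thesis
        unfolding sum_distrib_left sum_distrib_right sum.swap[where A = "{..<S}"]
        by (simp add: mult_ac)
    qed
    \<comment> \<open>One factor \<open>R\<close> is written as a difference of two combinations of
      the \<open>F s\<close>, with coefficients \<open>w\<close> and \<open>v\<close>;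
      \<open>comb\<close> annihilates both.\<close>
    have "(\<Sum>j<n. \<Sum>i<m. (R i j)\<^sup>2) = (\<Sum>j<n. \<Sum>i<m. (\<Sum>s<S. w $ s * F s $$ (i, j)) * R i j)
        - (\<Sum>j<n. \<Sum>i<m. (\<Sum>s<S. v $ s * F s $$ (i, j)) * R i j)"
      unfolding sum_subtractf[symmetric]
      by (intro sum.cong refl) (simp add: R_def span power2_eq_square left_diff_distrib)
    then have "(\<Sum>j<n. \<Sum>i<m. (R i j)\<^sup>2) = 0" by (simp add: comb)
    then show "\<forall>i<m. \<forall>j<n. R i j = 0" by (auto simp: sum_nonneg_eq_0_iff sum_nonneg)
  qed auto
  finally show ?thesis unfolding R_def by auto
qed

section \<open>Minimizers as zeros, and the analysis problem\<close>

text \<open>Both the quadratic problem and the analysis problem have minimum value 0, so their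
  minimizers are found as feasible zeros.\<close>

lemma is_arg_min_iff_zero:
  fixes f :: "'a \<Rightarrow> real"
  assumes "\<And>x. P x \<Longrightarrow> 0 \<le> f x" and "P a" and "f a = 0"
  shows "is_arg_min f P x \<longleftrightarrow> P x \<and> f x = 0"
  unfolding is_arg_min_linorder using assms by force

theorem theorem3p6:
  fixes S M :: nat and N :: "nat \<Rightarrow> nat"
    and X :: "nat \<Rightarrow> real mat" and p :: "nat \<Rightarrow> real vec"
    and Y :: "real mat" and q :: "real vec"
    and \<pi> F :: "nat \<Rightarrow> real mat"
    and Q K :: "real mat" and b :: "real vec"
  assumes X: "\<And>s. s < S \<Longrightarrow> X s \<in> carrier_mat (N s) (N s)"
    and p: "\<And>s. s < S \<Longrightarrow> p s \<in> pos_prob_vecs (N s)"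
    and Y: "Y \<in> carrier_mat M M"
    and q: "q \<in> pos_prob_vecs M"
    and plan: "\<And>s. s < S \<Longrightarrow> optimal_plan (X s) (p s) Y q (\<pi> s)"
    and F: "\<And>s. s < S \<Longrightarrow> F s = recip_outer q \<odot> (transpose_mat (\<pi> s) * X s * \<pi> s)"
    and Q: "Q = mat S S (\<lambda>(s, r). trace (transpose_mat (F s - Y) * (F r - Y)))"
    and K: "K = mat S S (\<lambda>(s, r). trace (transpose_mat (F s) * F r))"
    and b: "b = vec S (\<lambda>s. trace (transpose_mat Y * F s))"
    and bary: "Y \<in> Bary S X p q"
  shows "(\<forall>u\<in>carrier_vec S. \<forall>v\<in>carrier_vec S. \<forall>t\<in>{0..1}.
           (t \<cdot>\<^sub>v u + (1 - t) \<cdot>\<^sub>v v) \<bullet> (Q *\<^sub>v (t \<cdot>\<^sub>v u + (1 - t) \<cdot>\<^sub>v v))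
             \<le> t * (u \<bullet> (Q *\<^sub>v u)) + (1 - t) * (v \<bullet> (Q *\<^sub>v v))) \<and>
         (analysis_solutions S X p q Y \<noteq> {}) \<and>
         (\<forall>w\<in>analysis_solutions S X p q Y.
           Y \<in> synthesis_solutions S X p q w \<and>
           is_arg_min (\<lambda>v. v \<bullet> (Q *\<^sub>v v)) (\<lambda>v. v \<in> simplex S) w) \<and>
         (\<forall>w. is_arg_min (\<lambda>v. v \<bullet> (Q *\<^sub>v v)) (\<lambda>v. v \<in> simplex S) w \<longleftrightarrow>
             w \<in> simplex S \<and> K *\<^sub>v w = b)"
proof -
  \<comment> \<open>This property is the common link: within the simplex it is equivalent to a zero
    of the quadratic form and to the linear system, and it follows when \<open>Y\<close> solves the
    synthesis problem with weights \<open>w\<close>.\<close>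
  let ?mean = "\<lambda>w. \<forall>i<M. \<forall>j<M. Y $$ (i, j) = (\<Sum>s<S. w $ s * F s $$ (i, j))"
  have qd: "dim_vec q = M" using q unfolding pos_prob_vecs_def by auto
  have Fc: "F s \<in> carrier_mat M M" if "s < S" for s
    using qd unfolding F[OF that] hadamard_def recip_outer_def by simp
  have D: "F s - Y \<in> carrier_mat M M" if "s < S" for s by (rule minus_carrier_mat[OF Y])
  have mean: "?mean w" if "w \<in> simplex S" "Y \<in> synthesis_solutions S X p q w" for w
    using synthesis_solution_eq_mean[OF X p Y q plan F that] by blast
  obtain w0 where w0: "w0 \<in> simplex S" and sol0: "Y \<in> synthesis_solutions S X p q w0"
    using bary unfolding Bary_def by auto
  have simplexD: "v \<in> carrier_vec S" if "v \<in> simplex S" for v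
    using that unfolding simplex_def by auto
  have zero: "w \<bullet> (Q *\<^sub>v w) = 0 \<longleftrightarrow> ?mean w" if "w \<in> simplex S" for w
    using mean_eq_iff_quadratic_form_0[OF Fc Y Q that] .
  have nonneg: "0 \<le> v \<bullet> (Q *\<^sub>v v)" if "v \<in> simplex S" for v
    unfolding Q using quadratic_form_gram[where D = "\<lambda>s. F s - Y", OF D simplexD[OF that]]
    by (simp add: sum_nonneg)
  have argmin: "is_arg_min (\<lambda>v. v \<bullet> (Q *\<^sub>v v)) (\<lambda>v. v \<in> simplex S) w \<longleftrightarrow> w \<in> simplex S \<and> ?mean w"
    for w
    using is_arg_min_iff_zero[where P = "\<lambda>v. v \<in> simplex S" and f = "\<lambda>v. v \<bullet> (Q *\<^sub>v v)", OF nonneg w0]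
      zero[OF w0] mean[OF w0 sol0] zero by blast
  \<comment> \<open>The weights \<open>w0\<close> supply the coefficients that place
    \<open>Y\<close> in the span of the \<open>F s\<close>.\<close>
  have linear: "K *\<^sub>v w = b \<longleftrightarrow> ?mean w" if "w \<in> simplex S" for w
    using mean[OF w0 sol0] mean_eq_iff_linear_system[OF Fc Y K b _ simplexD[OF that], of w0] by blast
  let ?P = "\<lambda>(w, Z). w \<in> simplex S \<and> Z \<in> synthesis_solutions S X p q w"
  have d0: "(d_a Y Y)\<^sup>2 = 0" using d_a_power2_eq_0_iff[OF Y Y] by simp
  \<comment> \<open>Since \<open>Y\<close> is itself a barycenter, the pair of \<open>w0\<close> and
    \<open>Y\<close> is feasible and has loss 0.\<close>
  have analysis: "is_arg_min (\<lambda>(w, Z). (d_a Y Z)\<^sup>2) ?P x \<longleftrightarrow> ?P x \<and> (\<lambda>(w, Z). (d_a Y Z)\<^sup>2) x = 0" for x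
    by (rule is_arg_min_iff_zero[where a = "(w0, Y)"]) (auto simp: w0 sol0 d0)
  have ne: "w0 \<in> analysis_solutions S X p q Y"
    unfolding analysis_solutions_def analysis using w0 sol0 d0 by auto
  have sols: "w \<in> simplex S \<and> Y \<in> synthesis_solutions S X p q w"
    if w: "w \<in> analysis_solutions S X p q Y" for w
  proof -
    obtain Z where Z: "w \<in> simplex S" "Z \<in> synthesis_solutions S X p q w" "(d_a Y Z)\<^sup>2 = 0"
      using w unfolding analysis_solutions_def analysis by auto
    have "Z \<in> carrier_mat M M"
      using Z(2) qd unfolding synthesis_solutions_def is_arg_min_def by auto
    \<comment> \<open>Zero loss identifies the synthesis solution \<open>Z\<close> with
      \<open>Y\<close>, so \<open>Y\<close> solves the synthesis problem with the weights
      \<open>w\<close>.\<close>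
    then show ?thesis using Z d_a_power2_eq_0_iff[OF Y] by auto
  qed
  have convex: "\<forall>u\<in>carrier_vec S. \<forall>v\<in>carrier_vec S. \<forall>t\<in>{0..1}.
    (t \<cdot>\<^sub>v u + (1 - t) \<cdot>\<^sub>v v) \<bullet> (Q *\<^sub>v (t \<cdot>\<^sub>v u + (1 - t) \<cdot>\<^sub>v v))
      \<le> t * (u \<bullet> (Q *\<^sub>v u)) + (1 - t) * (v \<bullet> (Q *\<^sub>v v))"
    by (intro ballI quadratic_form_gram_convex[where D = "\<lambda>s. F s - Y", OF D Q]) auto
  have iff: "is_arg_min (\<lambda>v. v \<bullet> (Q *\<^sub>v v)) (\<lambda>v. v \<in> simplex S) w
      \<longleftrightarrow> w \<in> simplex S \<and> K *\<^sub>v w = b" for w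
    unfolding argmin using linear[of w] by (cases "w \<in> simplex S") simp_all
  have "Y \<in> synthesis_solutions S X p q w \<and> is_arg_min (\<lambda>v. v \<bullet> (Q *\<^sub>v v)) (\<lambda>v. v \<in> simplex S) w"
    if "w \<in> analysis_solutions S X p q Y" for w
    unfolding argmin using sols[OF that] mean[of w] by (intro conjI) auto
  with ne convex iff show ?thesis by (intro conjI ballI allI) (rule convex[rule_format], auto)
qed

end
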